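(* Let $b,s,k$ be positive integers, let $r=4bs+1$, and set \[ D:=r^k+\left(br^k+s\right)^2. \] Define $c_1,\dots,c_k$ by $c_i=2br^{(i-1)/2}$ for odd $i$ and $c_i=2br^{k-i/2}$ for even $i$ (so the sequence is $2b,\,2br^{k-1},\,2br,\,2br^{k-2},\,2br^2,\,2br^{k-3},\dots$, of length $k$). Then $l(D)=2k+1$ and \[ \sqrt D=[br^k+s;\overline{c_1,c_2,\dots,c_k,\,c_k,\dots,c_2,c_1,\,2(br^k+s)}]. \]
   Context: For a positive non-square integer $D$, $l(D)$ denotes the length of the fundamental (shortest) period of the regular continued fraction expansion of $\sqrt D$. $[a_0;\overline{b_1,\dots,b_m}]$ denotes the regular continued fraction whose partial quotients after $a_0$ are the block $b_1,\dots,b_m$ repeated infinitely often. *)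

theory Defs
  imports "HOL-Analysis.Analysis"
begin

text \<open>The finite continued fraction $[a_0; a_1, \dots, a_n]$.\<close>

fun convergent_of :: "(nat \<Rightarrow> int) \<Rightarrow> nat \<Rightarrow> real" where
  "convergent_of a 0 = of_int (a 0)"
| "convergent_of a (Suc n) = of_int (a 0) + 1 / convergent_of (\<lambda>i. a (Suc i)) n"

text \<open>
  \<open>a\<close> is an infinite regular continued fraction whose value is \<open>x\<close>.
  Such an \<open>x\<close> is necessarily irrational and \<open>a\<close> is uniquely determined by it.
\<close>

definition regular_cfrac :: "(nat \<Rightarrow> int) \<Rightarrow> real \<Rightarrow> bool" where
  "regular_cfrac a x \<longleftrightarrow> (\<forall>n\<ge>1. a n \<ge> 1) \<and> convergent_of a \<longlonglongrightarrow> x"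

text \<open>The coefficient sequence of $[a_0; \overline{b_1, \dots, b_m}]$, for a nonempty block.\<close>

definition periodic_cfrac :: "int \<Rightarrow> int list \<Rightarrow> nat \<Rightarrow> int" where
  "periodic_cfrac a0 bs n = (if n = 0 then a0 else bs ! ((n - 1) mod length bs))"

text \<open>
  The continued fraction algorithm. For irrational \<open>x\<close> the partial quotients form the
  regular continued fraction of \<open>x\<close>; for rational \<open>x\<close> the complete quotients
  are eventually $0$ because division by zero yields zero.
\<close>

fun complete_quotient :: "real \<Rightarrow> nat \<Rightarrow> real" where
  "complete_quotient x 0 = x"
| "complete_quotient x (Suc n) = 1 / frac (complete_quotient x n)"

definition partial_quotient :: "real \<Rightarrow> nat \<Rightarrow> int" where
  "partial_quotient x n = \<lfloor>complete_quotient x n\<rfloor>"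

text \<open>
  The length of the shortest period of the expansion of $\sqrt D$; only meaningful
  if \<open>D\<close> is not a square. The preperiod is left arbitrary.
\<close>

definition sqrt_period_length :: "nat \<Rightarrow> nat" where
  "sqrt_period_length D =
     (LEAST m. m > 0 \<and> (\<exists>N. \<forall>n\<ge>N.
        partial_quotient (sqrt (real D)) (n + m) = partial_quotient (sqrt (real D)) n))"

end

theory Submission
  imports Defs
begin

text \<open>
  Put $q = br^k+s$ and $p = br^k-s$. Since $r = 4bs+1$, we have $D-q^2 = r^k$ and
  $D-p^2 = r^{k+1}$, so the complete quotients of $\sqrt D$ after the first are
  $(q+\sqrt D)/r^{k-j}$ and $(p+\sqrt D)/r^{j+1}$ alternately, for $j = 0, 1, \dots$, up to
  $q+\sqrt D$, after which they repeat. The partial quotient $2q$ of the latter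
  exceeds all the others, so it occurs only at multiples of $2k+1$ and no shorter period exists.
\<close>

section \<open>Convergence of a continued fraction with prescribed complete quotients\<close>

lemma convergent_of_ge_1:
  assumes "\<And>n. a n \<ge> 1"
  shows "convergent_of a n \<ge> 1"
  using assms
proof (induction n arbitrary: a)
  case (Suc n)
  have "convergent_of (\<lambda>i. a (Suc i)) n \<ge> 1"
    by (intro Suc.IH Suc.prems)
  moreover have "real_of_int (a 0) \<ge> 1"
    using Suc.prems[of 0] by simp
  ultimately show ?case
    by (simp add: add_increasing2)
qed simp

lemma convergent_of_Suc_error:
  assumes rec: "\<And>n. y n = of_int (a n) + 1 / y (Suc n)"
    and gt: "\<And>n. y (Suc n) > 1"
    and a: "\<And>n. a (Suc n) \<ge> 1"
  shows "\<bar>convergent_of a (Suc n) - y 0\<bar>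
    \<le> \<bar>convergent_of (\<lambda>i. a (Suc i)) n - y 1\<bar> / y 1"
proof -
  let ?c = "convergent_of (\<lambda>i. a (Suc i)) n"
  have c: "?c \<ge> 1"
    using a by (intro convergent_of_ge_1)
  have y: "y 1 > 1"
    using gt[of 0] by simp
  have "convergent_of a (Suc n) - y 0 = 1 / ?c - 1 / y 1"
    by (simp add: rec[of 0])
  also have "\<dots> = (y 1 - ?c) / (?c * y 1)"
    using c y by (simp add: field_simps)
  also have "\<bar>\<dots>\<bar> = \<bar>?c - y 1\<bar> / (?c * y 1)"
    using c y by (simp add: abs_divide abs_mult abs_minus_commute)
  also have "\<dots> \<le> \<bar>?c - y 1\<bar> / (1 * y 1)"
    using c y by (intro divide_left_mono mult_right_mono) auto
  finally show ?thesis by simp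
qed

text \<open>One step divides the error by \<open>y 1\<close>, which may be arbitrarily close to 1.
  Two steps divide it by \<open>y 1 * y 2 = a 1 * y 2 + 1\<close>, which is at least 2. Hence the
  error halves every second step, and the induction advances by two.\<close>

lemma convergent_of_error:
  assumes "\<And>n. y n = of_int (a n) + 1 / y (Suc n)"
    and "\<And>n. y (Suc n) > 1"
    and "\<And>n. a (Suc n) \<ge> 1"
  shows "\<bar>convergent_of a n - y 0\<bar> \<le> (1 / 2) ^ (n div 2)"
  using assms
proof (induction n arbitrary: a y rule: induct_nat_012)
  case 0
  show ?case
    using "0.prems"(1)[of 0] "0.prems"(2)[of 0] by simp
next
  case 1
  have y: "y 1 > 1" "y (Suc 1) > 1"
    using "1.prems"(2) by simp_all
  have "\<bar>convergent_of a 1 - y 0\<bar> \<le> \<bar>of_int (a 1) - y 1\<bar> / y 1"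
    using convergent_of_Suc_error[of y a 0, OF "1.prems"] by simp
  also have "\<dots> = 1 / y (Suc 1) / y 1"
    using y "1.prems"(1)[of 1] by simp
  also have "\<dots> \<le> 1"
    using y mult_mono[of 1 "y (Suc 1)" 1 "y 1"] by simp
  finally show ?case by simp
next
  case (ge2 n)
  define e where "e = \<bar>convergent_of (\<lambda>i. a (Suc (Suc i))) n - y 2\<bar>"
  have e: "e \<le> (1 / 2) ^ (n div 2)"
    unfolding e_def
    using ge2.IH(1)[of "\<lambda>i. y (Suc (Suc i))" "\<lambda>i. a (Suc (Suc i))", OF ge2.prems]
    by (simp add: numeral_2_eq_2)
  have y: "y 1 > 1" "y 2 > 1"
    using ge2.prems(2)[of 0] ge2.prems(2)[of 1] by (simp_all add: numeral_2_eq_2)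
  have "y 1 * y 2 = of_int (a 1) * y 2 + 1"
    using ge2.prems(1)[of 1] y by (simp add: numeral_2_eq_2 field_simps)
  moreover have "1 * 1 \<le> of_int (a 1) * y 2"
    using ge2.prems(3)[of 0] y by (intro mult_mono) auto
  ultimately have yy: "y 1 * y 2 \<ge> 2" by simp
  have "\<bar>convergent_of a (Suc (Suc n)) - y 0\<bar>
      \<le> \<bar>convergent_of (\<lambda>i. a (Suc i)) (Suc n) - y 1\<bar> / y 1"
    using ge2.prems by (rule convergent_of_Suc_error)
  also have "\<dots> \<le> (e / y 2) / y 1"
    using convergent_of_Suc_error[of "\<lambda>i. y (Suc i)" "\<lambda>i. a (Suc i)" n, OF ge2.prems] y
    by (intro divide_right_mono) (simp_all add: e_def numeral_2_eq_2)
  also have "\<dots> = e / (y 1 * y 2)" by simp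
  also have "\<dots> \<le> e / 2"
    using yy by (intro divide_left_mono) (auto simp: e_def)
  also have "\<dots> \<le> (1 / 2) ^ (Suc (Suc n) div 2)"
    using e by simp
  finally show ?case .
qed

text \<open>Since \<open>1 / y (Suc n)\<close> lies strictly between 0 and 1, the recursion forces
  \<open>a n\<close> to be the floor of \<open>y n\<close>. So \<open>y\<close> is exactly what the
  algorithm produces, and one set of equations yields both the limit and the partial
  quotients.\<close>

lemma cfrac_of_complete_quotients:
  assumes rec: "\<And>n. y n = of_int (a n) + 1 / y (Suc n)"
    and gt: "\<And>n. y (Suc n) > 1"
  shows "regular_cfrac a (y 0)" and "partial_quotient (y 0) = a"
proof -
  have inv: "0 < 1 / y (Suc n)" "1 / y (Suc n) < 1" for n
    using gt[of n] by auto
  have floor: "\<lfloor>y n\<rfloor> = a n" for n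
    using rec[of n] inv[of n] by linarith
  have cq: "complete_quotient (y 0) n = y n" for n
  proof (induction n)
    case (Suc n)
    have "frac (y n) = 1 / y (Suc n)"
      using rec[of n] floor[of n] by (simp add: frac_def)
    then show ?case using Suc by simp
  qed simp
  show "partial_quotient (y 0) = a"
    by (rule ext) (simp add: partial_quotient_def cq floor)
  have a: "a (Suc n) \<ge> 1" for n
    using floor[of "Suc n"] gt[of n] by linarith
  have "(\<lambda>n. (1 / 2) ^ (n div 2)) \<longlonglongrightarrow> (0::real)"
    by (rule filterlim_compose[OF LIMSEQ_power_zero filterlim_at_top_div_const_nat]) auto
  then have "(\<lambda>n. convergent_of a n - y 0) \<longlonglongrightarrow> 0"
    by (rule Lim_null_comparison[rotated])
       (use convergent_of_error[of y a, OF rec gt a] in simp)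
  then have "convergent_of a \<longlonglongrightarrow> y 0"
    by (simp add: LIM_zero_iff)
  moreover have "a n \<ge> 1" if "n \<ge> 1" for n
    using a[of "n - 1"] that by simp
  ultimately show "regular_cfrac a (y 0)"
    by (simp add: regular_cfrac_def)
qed

section \<open>Periodic expansions and their shortest period\<close>

lemma periodic_cfrac_of_complete_quotients:
  assumes x: "x = of_int a0 + 1 / z 0"
    and rec: "\<And>i. i < length bs \<Longrightarrow> z i = of_int (bs ! i) + 1 / z (Suc i mod length bs)"
    and gt: "\<And>i. i < length bs \<Longrightarrow> z i > 1"
    and bs: "bs \<noteq> []"
  shows "regular_cfrac (periodic_cfrac a0 bs) x"
    and "partial_quotient x = periodic_cfrac a0 bs"
proof -
  \<comment> \<open>The finitely many equations for \<open>z\<close> close into a cycle; unrolling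
    it shifts indices by one, because \<open>x\<close> itself precedes the period.\<close>
  define y where "y n = (if n = 0 then x else z ((n - 1) mod length bs))" for n
  have y_rec: "y n = of_int (periodic_cfrac a0 bs n) + 1 / y (Suc n)" for n
  proof (cases n)
    case 0
    then show ?thesis by (simp add: y_def periodic_cfrac_def x)
  next
    case (Suc m)
    then show ?thesis
      using rec[of "m mod length bs"] bs by (simp add: y_def periodic_cfrac_def mod_Suc_eq)
  qed
  have y_gt: "y (Suc n) > 1" for n
    using gt bs by (simp add: y_def)
  have "y 0 = x" by (simp add: y_def)
  then show "regular_cfrac (periodic_cfrac a0 bs) x"
    and "partial_quotient x = periodic_cfrac a0 bs"
    using cfrac_of_complete_quotients[of y "periodic_cfrac a0 bs", OF y_rec y_gt] by simp_all
qed

text \<open>The entry \<open>d\<close> occurs once per block and so marks the multiples of the block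
  length. Any eventual period carries marks to marks and is therefore itself a multiple.\<close>

lemma sqrt_period_length_eqI:
  assumes pq: "partial_quotient (sqrt (real D)) = periodic_cfrac a0 (bs @ [d])"
    and d: "d \<notin> set bs"
  shows "sqrt_period_length D = Suc (length bs)"
  unfolding sqrt_period_length_def
proof (rule Least_equality)
  let ?L = "Suc (length bs)"
  \<comment> \<open>Index 0 stays out, since \<open>a0\<close> need not equal
    \<open>d\<close>.\<close>
  have period: "periodic_cfrac a0 (bs @ [d]) (n + ?L) = periodic_cfrac a0 (bs @ [d]) n"
    if "n \<ge> 1" for n
  proof -
    have eq: "n + ?L - 1 = n - 1 + ?L" using that by simp
    have "(n + ?L - 1) mod ?L = (n - 1) mod ?L"
      unfolding eq by (rule mod_add_self2)
    then show ?thesis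
      using that by (simp add: periodic_cfrac_def)
  qed
  then show "0 < ?L \<and> (\<exists>N. \<forall>n\<ge>N.
      partial_quotient (sqrt (real D)) (n + ?L) = partial_quotient (sqrt (real D)) n)"
    unfolding pq by blast
next
  let ?L = "Suc (length bs)"
  fix m
  assume m: "0 < m \<and> (\<exists>N. \<forall>n\<ge>N.
      partial_quotient (sqrt (real D)) (n + m) = partial_quotient (sqrt (real D)) n)"
  then obtain N where N: "\<And>n. n \<ge> N \<Longrightarrow>
      periodic_cfrac a0 (bs @ [d]) (n + m) = periodic_cfrac a0 (bs @ [d]) n"
    unfolding pq by blast
  have d_iff: "periodic_cfrac a0 (bs @ [d]) n = d \<longleftrightarrow> ?L dvd n" if n: "n \<ge> 1" for n
  proof -
    have "(bs @ [d]) ! i = d \<longleftrightarrow> i = length bs" if "i < ?L" for i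
      using that d nth_mem[of i bs] by (auto simp: nth_append less_Suc_eq)
    then have "periodic_cfrac a0 (bs @ [d]) n = d \<longleftrightarrow> (n - 1) mod ?L = length bs"
      using n by (simp add: periodic_cfrac_def)
    also have "\<dots> \<longleftrightarrow> Suc (n - 1) mod ?L = 0"
      by (simp add: mod_Suc)
    finally show ?thesis using n by (simp add: dvd_eq_mod_eq_0)
  qed
  \<comment> \<open>A marked index chosen beyond \<open>N\<close>, where the assumed period
    \<open>m\<close> already applies.\<close>
  let ?n = "?L * Suc N"
  have "?n \<ge> N" "?n \<ge> 1" by simp_all
  then have "periodic_cfrac a0 (bs @ [d]) (?n + m) = d"
    using N[of ?n] d_iff[of ?n] by (metis dvd_triv_left)
  then have "?L dvd ?n + m"
    using d_iff[of "?n + m"] \<open>?n \<ge> 1\<close> by linarith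
  then have "?L dvd m"
    using dvd_add_right_iff[of ?L ?n m] by (metis dvd_triv_left)
  then show "?L \<le> m"
    using m by (auto dest: dvd_imp_le)
qed

theorem theorem6:
  fixes b s k r D :: nat and c :: "nat \<Rightarrow> nat"
  assumes "b > 0" and "s > 0" and "k > 0"
    and "r = 4 * b * s + 1"
    and "D = r ^ k + (b * r ^ k + s) ^ 2"
    and "\<And>i. 1 \<le> i \<Longrightarrow> i \<le> k \<Longrightarrow> odd i \<Longrightarrow> c i = 2 * b * r ^ ((i - 1) div 2)"
    and "\<And>i. 1 \<le> i \<Longrightarrow> i \<le> k \<Longrightarrow> even i \<Longrightarrow> c i = 2 * b * r ^ (k - i div 2)"
  shows "sqrt_period_length D = 2 * k + 1 \<and>
    regular_cfrac
      (periodic_cfrac (int (b * r ^ k + s))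
        (map (\<lambda>i. int (c i)) [1..<k + 1] @ rev (map (\<lambda>i. int (c i)) [1..<k + 1])
          @ [int (2 * (b * r ^ k + s))]))
      (sqrt (real D))"
proof -
  define q where "q = b * r ^ k + s"
  define cs where "cs = map (\<lambda>i. int (c i)) [1..<k + 1] @ rev (map (\<lambda>i. int (c i)) [1..<k + 1])"
  \<comment> \<open>Exponents for the 0-based index of \<open>cs\<close>. As
    \<open>e (2 * k - 1 - i) = e i\<close> for \<open>i < 2 * k\<close>, a single formula covers
    both the block and its reversal.\<close>
  define e where "e i = (if even i then i div 2 else k - 1 - i div 2)" for i
  have len: "length cs = 2 * k" by (simp add: cs_def)
  have cs_nth: "cs ! i = int (2 * b * r ^ e i)" if i: "i < 2 * k" for i
  proof (cases "i < k")
    case True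
    then have "cs ! i = int (c (Suc i))"
      by (simp add: cs_def nth_append del: upt_Suc)
    also have "c (Suc i) = 2 * b * r ^ e i"
    proof (cases "even i")
      case True
      then show ?thesis
        using assms(6)[of "Suc i"] \<open>i < k\<close> by (simp add: e_def)
    next
      case False
      moreover from this have "Suc i div 2 = Suc (i div 2)" by presburger
      ultimately show ?thesis
        using assms(7)[of "Suc i"] \<open>i < k\<close> by (simp add: e_def)
    qed
    finally show ?thesis .
  next
    case False
    then obtain m where m: "i = k + m" "m < k"
      using i by (metis add_less_cancel_left le_Suc_ex linorder_not_less mult_2)
    have "cs ! i = rev (map (\<lambda>i. int (c i)) [1..<k + 1]) ! m"
      by (simp add: cs_def nth_append m del: upt_Suc)
    also have "\<dots> = int (c ([1..<k + 1] ! (k - Suc m)))"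
      using m by (simp add: rev_nth del: upt_Suc nth_upt)
    \<comment> \<open>Index \<open>i\<close> of the reversed half reads
      \<open>c (2 * k - i)\<close>, whose index has the parity of \<open>i\<close>, so the two cases
      of \<open>c\<close> match those of \<open>e\<close>.\<close>
    also have "[1..<k + 1] ! (k - Suc m) = 2 * k - i"
      using m by (subst nth_upt) auto
    also have "c (2 * k - i) = 2 * b * r ^ e i"
    proof (cases "even i")
      case True
      then obtain j where j: "i = 2 * j" by blast
      then have "2 * k - i = 2 * (k - j)" by simp
      then have "k - (2 * k - i) div 2 = i div 2" using i j by simp
      then show ?thesis
        using True assms(7)[of "2 * k - i"] i \<open>\<not> i < k\<close> by (simp add: e_def)
    next
      case odd: False
      then obtain j where j: "i = 2 * j + 1" by (rule oddE)
      then have "2 * k - i - 1 = 2 * (k - 1 - j)" by simp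
      then have "(2 * k - i - 1) div 2 = k - 1 - i div 2" using j by simp
      then show ?thesis
        using odd assms(6)[of "2 * k - i"] i \<open>\<not> i < k\<close> by (simp add: e_def)
    qed
    finally show ?thesis .
  qed

  have r_ge: "r \<ge> 1" using assms(4) by simp
  have not_in: "int (2 * q) \<notin> set cs"
  proof
    assume "int (2 * q) \<in> set cs"
    then obtain i where i: "i < 2 * k" "cs ! i = int (2 * q)"
      by (metis in_set_conv_nth len)
    then have "2 * q = 2 * b * r ^ e i"
      using cs_nth[OF i(1)] by (metis of_nat_eq_iff)
    then have "q = b * r ^ e i" by simp
    moreover have "e i \<le> k" using i by (auto simp: e_def)
    then have "b * r ^ e i \<le> b * r ^ k"
      using r_ge by (simp add: power_increasing)
    ultimately show False
      using \<open>s > 0\<close> by (simp add: q_def)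
  qed

  \<comment> \<open>Quadratic identities for the complete quotients\<close>
  define w where "w = sqrt (real D)"
  define Q where "Q = real q"
  define P where "P = Q - 2 * real s"
  define R where "R = real r"
  have Q_eq: "Q = real b * R ^ k + real s" by (simp add: Q_def q_def R_def)
  have R_ge: "R \<ge> 1" using r_ge by (simp add: R_def)
  have w2: "w * w = R ^ k + Q * Q"
    by (simp add: w_def assms(5) R_def Q_def q_def power2_eq_square)
  have wQ: "(w - Q) * (w + Q) = R ^ k"
    using w2 by (simp add: algebra_simps)
  have R_eq: "R = 4 * real b * real s + 1" by (simp add: R_def assms(4))
  have "(w - P) * (w + P) = w * w - P * P" by (simp add: algebra_simps)
  \<comment> \<open>Here \<open>Q * Q - P * P = (Q - P) * (Q + P) = 2 * s * (2 * b * R ^ k)\<close>;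
    the choice of \<open>r\<close> turns the sum with \<open>R ^ k\<close> into a pure power of
    \<open>R\<close>.\<close>
  also have "\<dots> = (4 * real b * real s + 1) * R ^ k"
    unfolding w2 P_def Q_eq by (simp add: algebra_simps)
  also have "\<dots> = R ^ Suc k" using R_eq by simp
  finally have wP: "(w - P) * (w + P) = R ^ Suc k" .
  have sum_PQ: "P + Q = 2 * real b * R ^ k" by (simp add: P_def Q_eq)
  have Rk: "R ^ k \<ge> 1" using R_ge by simp
  have Q_pos: "Q > 0" using \<open>s > 0\<close> by (simp add: Q_def q_def add_nonneg_pos)
  have w_gt: "w > Q"
    unfolding w_def using r_ge
    by (intro real_less_rsqrt) (simp add: assms(5) Q_def q_def R_def)
  have bRk: "real b * R ^ k \<ge> R ^ k" using \<open>b > 0\<close> Rk by simp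
  have PQ: "P < Q" using \<open>s > 0\<close> by (simp add: P_def)
  \<comment> \<open>Both numerators exceed \<open>R ^ k\<close>, the largest denominator occurring
    below, which makes every complete quotient greater than 1.\<close>
  have PwRk: "P + w > R ^ k" using sum_PQ w_gt bRk Rk by linarith
  then have QwRk: "Q + w > R ^ k" using PQ by linarith

  \<comment> \<open>\<open>z i\<close> is the complete quotient with index \<open>i + 1\<close>. At
    \<open>i = 2 * k\<close> the denominator is \<open>R ^ 0\<close>, leaving
    \<open>Q + w\<close>.\<close>
  define z where "z i = (if even i then (Q + w) / R ^ (k - i div 2)
                         else (P + w) / R ^ Suc (i div 2))" for i
  have z_gt: "z i > 1" if "i \<le> 2 * k" for i
  proof -
    have "R ^ (k - i div 2) \<le> R ^ k"
      using R_ge by (intro power_increasing) auto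
    moreover have "R ^ Suc (i div 2) \<le> R ^ k" if "odd i"
      using R_ge \<open>i \<le> 2 * k\<close> that by (intro power_increasing; presburger)
    moreover have "R ^ n > 0" for n using R_ge by simp
    ultimately show ?thesis
      using PwRk QwRk by (auto simp: z_def simp del: power_Suc)
  qed
  have Pw: "P + w > 0" and Qw: "Q + w > 0" using PwRk QwRk Rk by linarith+
  have R0: "R \<noteq> 0" using R_ge by simp
  \<comment> \<open>Subtracting \<open>2 * b * R ^ k = P + Q\<close> from \<open>Q + w\<close>
    leaves \<open>w - P\<close>. Its product with \<open>w + P\<close> is \<open>R ^ Suc k\<close>,
    which splits into the denominators of this quotient and the next.\<close>
  have z_even: "(Q + w) / R ^ (k - j) = 2 * real b * R ^ j + 1 / ((P + w) / R ^ Suc j)"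
    if "j < k" for j
  proof -
    have Rk': "R ^ k = R ^ (k - j) * R ^ j" using that by (simp flip: power_add)
    have "(Q + w - 2 * real b * R ^ k) * (P + w) = (w - P) * (w + P)"
      unfolding sum_PQ[symmetric] by (simp add: algebra_simps)
    also have "\<dots> = R ^ (k - j) * R ^ Suc j" using wP Rk' by simp
    finally have "(Q + w) * (P + w) =
        R ^ (k - j) * (2 * real b * R ^ j * (P + w) + R ^ Suc j)"
      unfolding Rk' by (simp add: algebra_simps)
    then show ?thesis using Pw R0 by (simp add: field_simps del: power_Suc)
  qed
  \<comment> \<open>The same computation with \<open>P\<close> and \<open>Q\<close> exchanged; the
    product is now \<open>R ^ k\<close>.\<close>
  have z_odd: "(P + w) / R ^ Suc j =
      2 * real b * R ^ (k - Suc j) + 1 / ((Q + w) / R ^ (k - Suc j))"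
    if "j < k" for j
  proof -
    have Rk': "R ^ k = R ^ (k - Suc j) * R ^ Suc j"
      using that by (simp flip: power_add del: power_Suc)
    have "(P + w - 2 * real b * R ^ k) * (Q + w) = (w - Q) * (w + Q)"
      unfolding sum_PQ[symmetric] by (simp add: algebra_simps)
    also have "\<dots> = R ^ (k - Suc j) * R ^ Suc j" using wQ Rk' by simp
    finally have "(P + w) * (Q + w) =
        R ^ Suc j * (2 * real b * R ^ (k - Suc j) * (Q + w) + R ^ (k - Suc j))"
      unfolding Rk' by (simp add: algebra_simps)
    then show ?thesis using Qw R0 by (simp add: field_simps del: power_Suc)
  qed
  have w_split: "w = Q + 1 / ((Q + w) / R ^ k)"
    using wQ Qw by (simp add: field_simps)

  let ?bs = "cs @ [int (2 * q)]"
  have z_rec: "z i = of_int (?bs ! i) + 1 / z (Suc i mod length ?bs)" if "i < length ?bs" for i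
  proof (cases "i = 2 * k")
    case True
    \<comment> \<open>At the end of the block the successor index wraps to 0, so the required
      equation is \<open>w_split\<close> with \<open>Q\<close> added to both sides.\<close>
    have "Q + w = 2 * Q + 1 / ((Q + w) / R ^ k)" using w_split by linarith
    then show ?thesis using True by (simp add: z_def nth_append len Q_def)
  next
    case False
    then have i: "i < 2 * k" using that len by simp
    then have "?bs ! i = int (2 * b * r ^ e i)"
      using cs_nth by (simp add: nth_append len)
    then have nth: "of_int (?bs ! i) = 2 * real b * R ^ e i" by (simp add: R_def)
    have m: "Suc i mod length ?bs = Suc i" using i len by simp
    show ?thesis
    proof (cases "even i")
      case True
      then have "i div 2 < k" using i by auto
      then show ?thesis
        unfolding nth m using True z_even[of "i div 2"] by (simp add: z_def e_def)
    next
      case False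
      moreover from this have "Suc i div 2 = Suc (i div 2)" by presburger
      moreover have "i div 2 < k" using i by auto
      ultimately show ?thesis
        unfolding nth m using z_odd[of "i div 2"] by (simp add: z_def e_def)
    qed
  qed
  have x: "sqrt (real D) = of_int (int q) + 1 / z 0"
    using w_split by (simp add: z_def w_def Q_def)
  have gt: "z i > 1" if "i < length ?bs" for i
    using z_gt that len by simp
  have "regular_cfrac (periodic_cfrac (int q) ?bs) (sqrt (real D))"
    and "partial_quotient (sqrt (real D)) = periodic_cfrac (int q) ?bs"
    by (rule periodic_cfrac_of_complete_quotients[of _ _ z, OF x z_rec gt]; simp)+
  then show ?thesis
    using sqrt_period_length_eqI[OF _ not_in] by (simp add: len q_def cs_def)
qed

end
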